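(* Let $\lambda>0$ and let $I$ be the KL regularizer. Assume there exist non-negative constants $L_1$ and $L_0$ such that: (i) for all $\theta_1,\theta_2\in\Theta$, $\sup_{x,y}\|\nabla_\theta c(G_{\theta_1}(x),y)-\nabla_\theta c(G_{\theta_2}(x),y)\|\le L_1\|\theta_1-\theta_2\|$; (ii) for all $\theta_1\in\Theta$, $\sup_{x,y}\|\nabla_\theta c(G_{\theta_1}(x),y)\|\le L_0$; (iii) for all $\theta_1,\theta_2\in\Theta$, $\sup_{x,y}|c(G_{\theta_1}(x),y)-c(G_{\theta_2}(x),y)|\le L_0\|\theta_1-\theta_2\|$. Then the function $h_\lambda$ is $L$-Lipschitz smooth on $\Theta$ (i.e. it is differentiable and its gradient is $L$-Lipschitz) with $L=L_1+\frac{L_0^2}{\lambda}$. Moreover, for any $\theta_1,\theta_2\in\Theta$, $$\|\pi^*(\theta_1)-\pi^*(\theta_2)\|_1\le\frac{L_0}{\lambda}\|\theta_1-\theta_2\|,$$ where $\pi^*(\theta)=\arg\min_{\pi\in\Pi(\mathbf p,\mathbf q)}H(\pi,\theta)$.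
   Context: $\mathbf q$ is a fixed probability distribution on a space $\mathcal X$ and $\mathbf p$ a fixed probability distribution on $\mathcal Y\subseteq\mathbb R^d$ (written as densities, or as probability mass functions when the supports are finite, in which case integrals denote finite sums). $\{G_\theta\}_{\theta\in\Theta}$ is a parametrized family of one-to-one maps $G_\theta:\mathcal X\to\mathbb R^d$, where $\Theta$ is a subset of a Euclidean space for which gradients in $\theta$ make sense (e.g. open), and $c:\mathbb R^d\times\mathbb R^d\to\mathbb R$ is a cost function; $\nabla_\theta c(G_\theta(x),y)$ is the gradient of $\theta\mapsto c(G_\theta(x),y)$. $\|\cdot\|$ is the Euclidean norm and $\|\cdot\|_1$ the $L^1$ norm, $\|\pi\|_1=\int_{\mathcal X}\int_{\mathcal Y}|\pi(x,y)|\,dy\,dx$. Suprema over $x,y$ are over $\mathcal X\times\mathcal Y$. $\Pi(\mathbf p,\mathbf q)$ is the set of joint distributions $\pi(x,y)$ on $\mathcal X\times\mathcal Y$ with $\int_{\mathcal X}\pi(x,y)\,dx=\mathbf p(y)$ and $\int_{\mathcal Y}\pi(x,y)\,dy=\mathbf q(x)$. The KL regularizer is $I(\pi)=\int\int\pi(x,y)\log\frac{\pi(x,y)}{\mathbf q(x)\mathbf p(y)}\,dx\,dy$. Define $$H(\pi,\theta)=\int_{\mathcal X}\int_{\mathcal Y}\pi(x,y)\,c(G_\theta(x),y)\,dy\,dx+\lambda I(\pi),\qquad h_\lambda(\theta)=\min_{\pi\in\Pi(\mathbf p,\mathbf q)}H(\pi,\theta),$$ the minimum being attained (uniquely, by strict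 convexity). Thus $h_\lambda(\theta)$ is the regularized optimal transport cost between the pushforward $G_\theta(\mathbf q)$ and $\mathbf p$. *)

theory Defs
  imports "HOL-Analysis.Analysis"
begin

(* Densities are taken with respect to reference measures: M on the sample space X = space M
   and N on Y = space N, a subset of a Euclidean space.  Lebesgue measure gives ordinary densities;
   counting measure on a finite set gives probability mass functions and finite sums. *)

definition prob_density :: "'a measure \<Rightarrow> ('a \<Rightarrow> real) \<Rightarrow> bool" where
  "prob_density M f \<longleftrightarrow>
     f \<in> borel_measurable M \<and> (\<forall>x\<in>space M. 0 \<le> f x) \<and> (\<integral>\<^sup>+x. ennreal (f x) \<partial>M) = 1"

(* Marginals are compared almost everywhere, as densities are determined only up to null sets;
   for counting measures this is equality at every point. *)
definition couplings ::
  "'a measure \<Rightarrow> 'b measure \<Rightarrow> ('a \<Rightarrow> real) \<Rightarrow> ('b \<Rightarrow> real) \<Rightarrow> ('a \<times> 'b \<Rightarrow> real) set" where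
  "couplings M N q p =
     {\<pi>. prob_density (M \<Otimes>\<^sub>M N) \<pi> \<and>
         (AE y in N. (\<integral>\<^sup>+x. ennreal (\<pi> (x, y)) \<partial>M) = ennreal (p y)) \<and>
         (AE x in M. (\<integral>\<^sup>+y. ennreal (\<pi> (x, y)) \<partial>N) = ennreal (q x))}"

(* Integral of a real function with values in [-\<infinity>, \<infinity>].  The Bochner integral would assign 0 to
   non-integrable functions, which would make couplings of infinite cost look cheap.  In ereal,
   \<infinity> - \<infinity> = \<infinity>, so an undefined integral counts as +\<infinity>. *)
definition ext_integral :: "'a measure \<Rightarrow> ('a \<Rightarrow> real) \<Rightarrow> ereal" where
  "ext_integral M f =
     enn2ereal (\<integral>\<^sup>+x. ennreal (f x) \<partial>M) - enn2ereal (\<integral>\<^sup>+x. ennreal (- f x) \<partial>M)"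

(* Where \<pi> = 0 the integrand is 0, the usual convention.  Points with q x * p y = 0 < \<pi> (x, y)
   form a null set for every coupling \<pi>, so the value of division by 0 is irrelevant. *)
definition KL_reg ::
  "'a measure \<Rightarrow> 'b measure \<Rightarrow> ('a \<Rightarrow> real) \<Rightarrow> ('b \<Rightarrow> real) \<Rightarrow> ('a \<times> 'b \<Rightarrow> real) \<Rightarrow> ereal" where
  "KL_reg M N q p \<pi> =
     ext_integral (M \<Otimes>\<^sub>M N) (\<lambda>(x, y). \<pi> (x, y) * ln (\<pi> (x, y) / (q x * p y)))"

definition OT_objective ::
  "'a measure \<Rightarrow> 'd measure \<Rightarrow> ('a \<Rightarrow> real) \<Rightarrow> ('d \<Rightarrow> real) \<Rightarrow> ('d \<Rightarrow> 'd \<Rightarrow> real) \<Rightarrow>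
   ('t \<Rightarrow> 'a \<Rightarrow> 'd) \<Rightarrow> real \<Rightarrow> ('a \<times> 'd \<Rightarrow> real) \<Rightarrow> 't \<Rightarrow> ereal" where
  "OT_objective M N q p c G lam \<pi> \<theta> =
     ext_integral (M \<Otimes>\<^sub>M N) (\<lambda>(x, y). \<pi> (x, y) * c (G \<theta> x) y) + ereal lam * KL_reg M N q p \<pi>"

definition OT_value ::
  "'a measure \<Rightarrow> 'd measure \<Rightarrow> ('a \<Rightarrow> real) \<Rightarrow> ('d \<Rightarrow> real) \<Rightarrow> ('d \<Rightarrow> 'd \<Rightarrow> real) \<Rightarrow>
   ('t \<Rightarrow> 'a \<Rightarrow> 'd) \<Rightarrow> real \<Rightarrow> 't \<Rightarrow> real" where
  "OT_value M N q p c G lam \<theta> =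
     real_of_ereal (INF \<pi>\<in>couplings M N q p. OT_objective M N q p c G lam \<pi> \<theta>)"

definition OT_plan ::
  "'a measure \<Rightarrow> 'd measure \<Rightarrow> ('a \<Rightarrow> real) \<Rightarrow> ('d \<Rightarrow> real) \<Rightarrow> ('d \<Rightarrow> 'd \<Rightarrow> real) \<Rightarrow>
   ('t \<Rightarrow> 'a \<Rightarrow> 'd) \<Rightarrow> real \<Rightarrow> 't \<Rightarrow> ('a \<times> 'd \<Rightarrow> real) \<Rightarrow> bool" where
  "OT_plan M N q p c G lam \<theta> \<pi> \<longleftrightarrow>
     is_arg_min (\<lambda>\<pi>. OT_objective M N q p c G lam \<pi> \<theta>) (\<lambda>\<pi>. \<pi> \<in> couplings M N q p) \<pi>"

(* Equals the iterated integral by Tonelli, for measurable \<pi> and sigma-finite M, N. *)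
definition L1_norm :: "'a measure \<Rightarrow> 'b measure \<Rightarrow> ('a \<times> 'b \<Rightarrow> real) \<Rightarrow> ennreal" where
  "L1_norm M N \<pi> = (\<integral>\<^sup>+z. ennreal \<bar>\<pi> z\<bar> \<partial>(M \<Otimes>\<^sub>M N))"

definition grad :: "('t::real_inner \<Rightarrow> real) \<Rightarrow> 't \<Rightarrow> 't" where
  "grad f \<theta> = (THE D. GDERIV f \<theta> :> D)"

definition lipschitz_smooth_on :: "'t::real_inner set \<Rightarrow> real \<Rightarrow> ('t \<Rightarrow> real) \<Rightarrow> bool" where
  "lipschitz_smooth_on \<Theta> L f \<longleftrightarrow>
     (\<forall>\<theta>\<in>\<Theta>. f differentiable (at \<theta>)) \<and> L-lipschitz_on \<Theta> (grad f)"

end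

theory Submission
  imports Defs
begin

text \<open>
  Pinsker's inequality makes the entropy 1-strongly convex with respect to the \<open>L\<^sup>1\<close> norm on
  probability densities, so the objective grows by at least \<open>lam / 2 * \<parallel>\<pi> - \<pi>\<^sup>*\<parallel>\<^sup>2\<close> away from an
  optimal plan \<open>\<pi>\<^sup>*\<close>.
  Adding this growth bound for the plans of two parameters, the entropy terms cancel and the
  Lipschitz bound on the cost gives the estimate for the plans.  Comparing each optimal value with
  the objective of the other parameter's plan sandwiches the increment of the value function
  between the increments of the cost integrated against the two plans.  These are quadratically
  close, whence the envelope formula: the gradient of the value is the cost gradient integrated
  against the optimal plan.
\<close>

subsection \<open>Strong convexity of the relative entropy\<close>

text \<open>The scalar inequality behind Pinsker's. Dividing by \<open>2 * u + 4\<close> turns it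
  into \<open>0 \<le> f u\<close> for a convex \<open>f\<close> whose value and slope vanish at 1,
  so \<open>f\<close> lies above its zero tangent there. The point \<open>u = 0\<close>, outside the
  domain of convexity, is the numerical check 3 \<le> 4.\<close>

lemma entropy_quadratic_bound:
  fixes u :: real
  assumes "0 \<le> u"
  shows "3 * (u - 1)\<^sup>2 \<le> (2 * u + 4) * (u * ln u - u + 1)"
proof (cases "u = 0")
  case False
  \<comment> \<open>The subtracted term is \<open>3/2 * (u - 1)\<^sup>2 / (u + 2)\<close> after
    polynomial division, a form that is easy to differentiate.\<close>
  define f where "f = (\<lambda>u::real. u * ln u - u + 1 - 3/2 * (u - 4 + 9 / (u + 2)))"
  define f' where "f' = (\<lambda>u::real. ln u - 3/2 + 27/2 / (u + 2)\<^sup>2)"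
  define f'' where "f'' = (\<lambda>u::real. 1 / u - 27 / (u + 2)^3)"
  have D1: "(f has_real_derivative f' x) (at x)" if "x > 0" for x
  proof -
    have "((\<lambda>u. u - 4 + 9 / (u + 2)) has_real_derivative (1 - 9 / (x + 2)\<^sup>2)) (at x)"
      using that by (auto intro!: derivative_eq_intros simp: power2_eq_square)
    moreover have "((\<lambda>u. u * ln u - u + 1) has_real_derivative ln x) (at x)"
      using that by (auto intro!: derivative_eq_intros)
    ultimately show ?thesis
      unfolding f_def f'_def using that
      by (intro DERIV_cong[OF DERIV_diff[OF _ DERIV_cmult]]) (auto simp: diff_divide_distrib)
  qed
  have D2: "(f' has_real_derivative f'' x) (at x)" if "x > 0" for x
  proof -
    have "((\<lambda>u. 27/2 / (u + 2)\<^sup>2) has_real_derivative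
        (0 * (x + 2)\<^sup>2 - 27/2 * (2 * (x + 2))) / ((x + 2)\<^sup>2 * (x + 2)\<^sup>2)) (at x)"
      using that by (intro DERIV_divide) (auto intro!: derivative_eq_intros)
    also have "(0 * (x + 2)\<^sup>2 - 27/2 * (2 * (x + 2))) / ((x + 2)\<^sup>2 * (x + 2)\<^sup>2) = - (27 / (x + 2)^3)"
      using that by (simp add: divide_simps) (simp add: algebra_simps power2_eq_square power3_eq_cube power4_eq_xxxx)
    finally have "((\<lambda>u. 27/2 / (u + 2)\<^sup>2) has_real_derivative - (27 / (x + 2)^3)) (at x)" .
    moreover have "((\<lambda>u. ln u - 3/2) has_real_derivative 1 / x) (at x)"
      using that by (auto intro!: derivative_eq_intros)
    ultimately show ?thesis
      unfolding f'_def f''_def by (intro DERIV_cong[OF DERIV_add]) auto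
  qed
  have pos: "0 \<le> f'' x" if "x > 0" for x
  proof -
    \<comment> \<open>AM-GM for \<open>x\<close>, 1, 1, as an explicit factorization.\<close>
    have "(x + 2)^3 - 27 * x = (x - 1)\<^sup>2 * (x + 8)"
      by (simp add: algebra_simps power2_eq_square power3_eq_cube)
    also have "\<dots> \<ge> 0" using that by simp
    finally show ?thesis
      using that unfolding f''_def by (simp add: divide_simps)
  qed
  have "convex_on {0<..} f"
    by (rule f''_ge0_imp_convex[where f' = f' and f'' = f'']) (use D1 D2 pos in auto)
  then have "f u - f 1 \<ge> f' 1 * (u - 1)"
    by (rule convex_on_imp_above_tangent)
      (use False assms D1[of 1] in \<open>auto simp: interior_open intro: has_field_derivative_at_within\<close>)
  then have "0 \<le> f u"
    by (simp add: f_def f'_def)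
  moreover have eq: "u - 4 + 9 / (u + 2) = (u - 1)\<^sup>2 / (u + 2)"
    using assms by (simp add: field_simps power2_eq_square)
  ultimately have "3/2 * ((u - 1)\<^sup>2 / (u + 2)) \<le> u * ln u - u + 1"
    unfolding f_def eq by linarith
  then show ?thesis
    using assms by (simp add: field_simps)
qed simp

text \<open>For the optimal \<open>s\<close> this is the pointwise form of Pinsker's inequality; keeping \<open>s\<close> free
  makes the bound linear in the quantities to be integrated.\<close>
lemma pinsker_pointwise:
  fixes a b s :: real
  assumes "0 \<le> a" "0 < b"
  shows "2 * s * \<bar>a - b\<bar> - s\<^sup>2 * ((2 * a + 4 * b) / 3) \<le> a * ln (a / b) - a + b"
proof -
  define u where "u = a / b"
  define A where "A = (2 * u + 4) / 3"
  have u: "0 \<le> u" "a = b * u" and A: "0 < A"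
    using assms by (auto simp: u_def A_def add_nonneg_pos)
  \<comment> \<open>Completing the square replaces the quadratic term by one linear in
    \<open>\<bar>u - 1\<bar>\<close>, with equality when
    \<open>s * A = \<bar>u - 1\<bar>\<close>.\<close>
  have "(\<bar>u - 1\<bar> - s * A)\<^sup>2 \<ge> 0" by simp
  then have "2 * s * \<bar>u - 1\<bar> * A - s\<^sup>2 * A * A \<le> (u - 1)\<^sup>2"
    by (simp add: power2_diff power_mult_distrib) (simp add: power2_eq_square algebra_simps)
  also have "\<dots> \<le> A * (u * ln u - u + 1)"
    using entropy_quadratic_bound[OF u(1)] by (simp add: A_def)
  finally have "A * (2 * s * \<bar>u - 1\<bar> - s\<^sup>2 * A) \<le> A * (u * ln u - u + 1)"
    by (simp add: algebra_simps)
  then have "2 * s * \<bar>u - 1\<bar> - s\<^sup>2 * A \<le> u * ln u - u + 1"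
    using A by simp
  from mult_left_mono[OF this, of b] have bound: "2 * s * (b * \<bar>u - 1\<bar>) - s\<^sup>2 * (b * A) \<le> a * ln u - a + b"
    using assms(2) unfolding u(2) by (simp add: algebra_simps)
  have eq1: "\<bar>a - b\<bar> = b * \<bar>u - 1\<bar>"
  proof -
    have "a - b = b * (u - 1)" using assms by (simp add: u_def field_simps)
    then show ?thesis using assms by (simp add: abs_mult)
  qed
  have eq2: "(2 * a + 4 * b) / 3 = b * A"
    using assms by (simp add: u_def A_def field_simps)
  show ?thesis
    using bound unfolding eq1 eq2 u_def .
qed

section \<open>Extended integrals and densities\<close>

lemma ext_integral_eq:
  assumes "integrable M f"
  shows "ext_integral M f = ereal (integral\<^sup>L M f)"
proof -
  have "(\<integral>\<^sup>+x. ennreal (f x) \<partial>M) < \<infinity>" "(\<integral>\<^sup>+x. ennreal (- f x) \<partial>M) < \<infinity>"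
    using assms by (auto simp: real_integrable_def less_top)
  then show ?thesis
    unfolding ext_integral_def real_lebesgue_integral_def[OF assms]
    by (auto simp: less_top_ennreal)
qed

text \<open>Since \<infinity> - \<infinity> = \<infinity> in ereal, an infinite positive part makes
  the difference infinite whatever the negative part is. Once the positive part is finite, an
  infinite negative part would give -\<infinity>.\<close>

lemma integrable_if_ext_integral_finite:
  assumes "f \<in> borel_measurable M" "\<bar>ext_integral M f\<bar> \<noteq> \<infinity>"
  shows "integrable M f"
proof -
  have "(\<integral>\<^sup>+x. ennreal (f x) \<partial>M) \<noteq> \<infinity>"
    using assms(2) by (auto simp: ext_integral_def)
  moreover have "(\<integral>\<^sup>+x. ennreal (- f x) \<partial>M) \<noteq> \<infinity>"
    using assms(2) calculation
    by (cases "\<integral>\<^sup>+x. ennreal (f x) \<partial>M") (auto simp: ext_integral_def)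
  ultimately show ?thesis
    using assms(1) by (simp add: real_integrable_def)
qed

lemma prob_density_integrable:
  assumes "prob_density M f"
  shows "integrable M f" "integral\<^sup>L M f = 1"
proof -
  have "has_bochner_integral M f 1"
    using assms by (intro has_bochner_integral_nn_integral) (auto simp: prob_density_def)
  then show "integrable M f" "integral\<^sup>L M f = 1"
    by (auto simp: has_bochner_integral_iff)
qed

section \<open>Entropy of a mixture\<close>

text \<open>The convexity gap of \<open>x * ln (x / r)\<close> is the average of the Bregman
  divergences of \<open>a\<close> and \<open>b\<close> from \<open>m\<close>, and the pointwise
  Pinsker bound applies to each. \<open>D\<close> is free here; on integration it becomes the
  \<open>L\<^sup>1\<close> distance of the two densities.\<close>

lemma entropy_strongly_convex_pointwise:
  fixes a b r t D :: real
  assumes "0 \<le> a" "0 \<le> b" "0 \<le> r" "r = 0 \<longrightarrow> a = 0 \<and> b = 0" "0 < t" "t < 1"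
  defines "m \<equiv> (1 - t) * a + t * b"
  shows "t * (1 - t) * (D * \<bar>a - b\<bar> - D\<^sup>2 / 6 * (t * a + (1 - t) * b + 2 * m))
         \<le> (1 - t) * (a * ln (a / r)) + t * (b * ln (b / r)) - m * ln (m / r)"
proof (cases "m = 0")
  case True
  then have "a = 0" "b = 0"
    using assms by (auto simp: add_nonneg_eq_0_iff)
  then show ?thesis
    by (simp add: m_def)
next
  case False
  then have m: "0 < m" and r: "0 < r"
    using assms by (auto simp: m_def less_le)
  define B where "B = (\<lambda>x. x * ln (x / m) - x + m)"
  \<comment> \<open>Moves the reference point from \<open>r\<close> to \<open>m\<close>; the terms
    \<open>x * ln (m / r)\<close> average to \<open>m * ln (m / r)\<close> and cancel.\<close>
  have ln_split: "x * ln (x / r) = x * ln (x / m) + x * ln (m / r)" if "0 \<le> x" for x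
    using that m r by (cases "x = 0") (auto simp: ln_div algebra_simps)
  have "(1 - t) * (a * ln (a / r)) + t * (b * ln (b / r)) - m * ln (m / r) = (1 - t) * B a + t * B b"
    unfolding ln_split[OF assms(1)] ln_split[OF assms(2)] B_def
    by (simp add: m_def algebra_simps)
  \<comment> \<open>For unit masses at \<open>L\<^sup>1\<close> distance \<open>D\<close>, the
    Pinsker bound for \<open>a\<close> against \<open>m\<close> integrates to
    \<open>2 * s * (t * D) - 2 * s\<^sup>2\<close>, maximal at \<open>s = t * D / 2\<close>. For
    \<open>b\<close> the roles of \<open>t\<close> and \<open>1 - t\<close> are exchanged.\<close>
  moreover have "(1 - t) * (2 * (t * D / 2) * \<bar>a - m\<bar> - (t * D / 2)\<^sup>2 * ((2 * a + 4 * m) / 3)) \<le> (1 - t) * B a"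
    using assms(1,6) m pinsker_pointwise[of a m "t * D / 2"] by (simp add: B_def)
  moreover have "t * (2 * ((1 - t) * D / 2) * \<bar>b - m\<bar> - ((1 - t) * D / 2)\<^sup>2 * ((2 * b + 4 * m) / 3)) \<le> t * B b"
    using assms(2,5) m pinsker_pointwise[of b m "(1 - t) * D / 2"] by (simp add: B_def)
  moreover have "\<bar>a - m\<bar> = t * \<bar>a - b\<bar>"
  proof -
    have "a - m = t * (a - b)"
      by (simp add: m_def algebra_simps)
    then show ?thesis
      using assms(5) by (simp add: abs_mult)
  qed
  moreover have "\<bar>b - m\<bar> = (1 - t) * \<bar>a - b\<bar>"
  proof -
    have "b - m = (1 - t) * (b - a)"
      by (simp add: m_def algebra_simps)
    then show ?thesis
      using assms(6) by (simp add: abs_mult abs_minus_commute)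
  qed
  moreover have "t * (1 - t) * (D * d - D\<^sup>2 / 6 * (t * a + (1 - t) * b + 2 * m))
      = (1 - t) * (2 * (t * D / 2) * (t * d) - (t * D / 2)\<^sup>2 * ((2 * a + 4 * m) / 3))
        + t * (2 * ((1 - t) * D / 2) * ((1 - t) * d) - ((1 - t) * D / 2)\<^sup>2 * ((2 * b + 4 * m) / 3))" for d
    by (simp add: power2_eq_square field_simps)
  ultimately show ?thesis
    by simp
qed

text \<open>Supplies an integrable minorant, so that the entropy integrand of a mixture can be
  dominated from both sides. It holds because \<open>m\<close> is at least
  \<open>(1 - t) * a\<close> and at least \<open>t * b\<close>, and the logarithm is
  monotone.\<close>

lemma entropy_mixture_lower_bound:
  fixes a b r t :: real
  assumes "0 \<le> a" "0 \<le> b" "0 \<le> r" "r = 0 \<longrightarrow> a = 0 \<and> b = 0" "0 < t" "t < 1"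
  defines "m \<equiv> (1 - t) * a + t * b"
  shows "(1 - t) * (a * ln (a / r) + ln (1 - t) * a) + t * (b * ln (b / r) + ln t * b) \<le> m * ln (m / r)"
proof -
  have le: "x * ln (x / r) + ln s * x \<le> x * ln (m / r)" if "0 \<le> x" "0 < s" "s * x \<le> m" "r = 0 \<longrightarrow> x = 0" for x s
  proof (cases "x = 0")
    case False
    with that assms(3) have pos: "0 < x" "0 < r" by auto
    then have "0 < s * x" using that by simp
    then have "ln (s * x / r) \<le> ln (m / r)"
      using that pos by (intro ln_mono) (auto simp: divide_right_mono)
    then have "x * (ln s + ln (x / r)) \<le> x * ln (m / r)"
      using pos that ln_mult[of s "x / r"] by (simp add: mult_left_mono)
    then show ?thesis
      by (simp add: algebra_simps)
  qed simp
  have "(1 - t) * (a * ln (a / r) + ln (1 - t) * a) \<le> (1 - t) * (a * ln (m / r))"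
    using assms by (intro mult_left_mono le) (auto simp: m_def)
  moreover have "t * (b * ln (b / r) + ln t * b) \<le> t * (b * ln (m / r))"
    using assms by (intro mult_left_mono le) (auto simp: m_def)
  ultimately show ?thesis
    by (simp add: m_def algebra_simps)
qed

text \<open>The integrable functions \<open>low\<close> and \<open>up\<close> enclose the integrand
  of the mixture almost everywhere. This gives integrability by domination, and integrating
  \<open>up\<close> gives the inequality.\<close>

lemma entropy_strongly_convex:
  fixes a b r :: "'z \<Rightarrow> real" and t :: real
  assumes "integrable P a" "integral\<^sup>L P a = 1" "integrable P b" "integral\<^sup>L P b = 1"
    and [measurable]: "r \<in> borel_measurable P"
    and AE: "AE z in P. 0 \<le> a z \<and> 0 \<le> b z \<and> 0 \<le> r z \<and> (r z = 0 \<longrightarrow> a z = 0 \<and> b z = 0)"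
    and inta: "integrable P (\<lambda>z. a z * ln (a z / r z))"
    and intb: "integrable P (\<lambda>z. b z * ln (b z / r z))"
    and t: "0 < t" "t < 1"
  defines "m \<equiv> \<lambda>z. (1 - t) * a z + t * b z"
  shows "integrable P (\<lambda>z. m z * ln (m z / r z))"
    and "(\<integral>z. m z * ln (m z / r z) \<partial>P)
      \<le> (1 - t) * (\<integral>z. a z * ln (a z / r z) \<partial>P) + t * (\<integral>z. b z * ln (b z / r z) \<partial>P)
         - t * (1 - t) / 2 * (\<integral>z. \<bar>a z - b z\<bar> \<partial>P)\<^sup>2"
proof -
  note [simp] = assms(1-4) inta intb
  have [measurable]: "a \<in> borel_measurable P" "b \<in> borel_measurable P"
    by (auto intro: borel_measurable_integrable)
  define D where "D = (\<integral>z. \<bar>a z - b z\<bar> \<partial>P)"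
  define low where "low z = (1 - t) * (a z * ln (a z / r z) + ln (1 - t) * a z)
    + t * (b z * ln (b z / r z) + ln t * b z)" for z
  define gap where "gap z = t * (1 - t) * (D * \<bar>a z - b z\<bar>
    - D\<^sup>2 / 6 * (t * a z + (1 - t) * b z + 2 * ((1 - t) * a z + t * b z)))" for z
  define up where "up z = (1 - t) * (a z * ln (a z / r z)) + t * (b z * ln (b z / r z)) - gap z" for z
  have [simp]: "integrable P low" "integrable P gap" "integrable P up"
    unfolding low_def gap_def up_def by auto
  have bounds: "AE z in P. low z \<le> m z * ln (m z / r z) \<and> m z * ln (m z / r z) \<le> up z"
    using AE
  proof eventually_elim
    case (elim z)
    show ?case
      using entropy_mixture_lower_bound[of "a z" "b z" "r z" t]
        entropy_strongly_convex_pointwise[of "a z" "b z" "r z" t D] elim t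
      by (simp add: low_def up_def gap_def m_def)
  qed
  show int: "integrable P (\<lambda>z. m z * ln (m z / r z))"
  proof (rule Bochner_Integration.integrable_bound)
    show "integrable P (\<lambda>z. \<bar>low z\<bar> + \<bar>up z\<bar>)"
      by simp
    show "AE z in P. norm (m z * ln (m z / r z)) \<le> norm (\<bar>low z\<bar> + \<bar>up z\<bar>)"
      using bounds by eventually_elim auto
  qed (simp add: m_def)
  \<comment> \<open>\<open>a\<close>, \<open>b\<close> and their mixture have mass 1, so the bracket
    multiplied by \<open>D\<^sup>2 / 6\<close> integrates to 3, and half of \<open>D * D\<close>
    remains.\<close>
  have gap: "(\<integral>z. gap z \<partial>P) = t * (1 - t) / 2 * D\<^sup>2"
    by (simp add: gap_def D_def[symmetric]) (simp add: power2_eq_square field_simps)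
  have "(\<integral>z. m z * ln (m z / r z) \<partial>P) \<le> (\<integral>z. up z \<partial>P)"
    by (rule integral_mono_AE) (use int bounds in auto)
  also have "\<dots> = (1 - t) * (\<integral>z. a z * ln (a z / r z) \<partial>P) + t * (\<integral>z. b z * ln (b z / r z) \<partial>P)
      - t * (1 - t) / 2 * D\<^sup>2"
    unfolding up_def by (simp add: gap)
  finally show "(\<integral>z. m z * ln (m z / r z) \<partial>P)
      \<le> (1 - t) * (\<integral>z. a z * ln (a z / r z) \<partial>P) + t * (\<integral>z. b z * ln (b z / r z) \<partial>P)
         - t * (1 - t) / 2 * (\<integral>z. \<bar>a z - b z\<bar> \<partial>P)\<^sup>2"
    by (simp add: D_def)
qed

subsection \<open>Gradients and couplings\<close>

text \<open>Hoelder pairing of an \<open>L\<^sup>1\<close> function with a bounded one. It serves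
  both the real-valued cost differences and the vector-valued cost gradients.\<close>

lemma norm_integral_scaleR_le:
  fixes k :: "'z \<Rightarrow> 'e::euclidean_space"
  assumes a: "integrable P a" and [measurable]: "k \<in> borel_measurable P"
    and bound: "\<And>z. z \<in> space P \<Longrightarrow> norm (k z) \<le> K"
  shows "integrable P (\<lambda>z. a z *\<^sub>R k z)"
    and "norm (\<integral>z. a z *\<^sub>R k z \<partial>P) \<le> K * (\<integral>z. \<bar>a z\<bar> \<partial>P)"
proof -
  have [measurable]: "a \<in> borel_measurable P"
    using a by (rule borel_measurable_integrable)
  have le: "norm (a z *\<^sub>R k z) \<le> K * \<bar>a z\<bar>" if "z \<in> space P" for z
    using bound[OF that] by (simp add: mult.commute[of K] mult_left_mono)
  show int: "integrable P (\<lambda>z. a z *\<^sub>R k z)"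
  proof (rule Bochner_Integration.integrable_bound)
    show "integrable P (\<lambda>z. K * \<bar>a z\<bar>)"
      using a by simp
    show "AE z in P. norm (a z *\<^sub>R k z) \<le> norm (K * \<bar>a z\<bar>)"
      by (rule AE_I2) (metis le abs_ge_self order_trans real_norm_def)
  qed simp
  have "norm (\<integral>z. a z *\<^sub>R k z \<partial>P) \<le> (\<integral>z. norm (a z *\<^sub>R k z) \<partial>P)"
    by (rule integral_norm_bound)
  also have "\<dots> \<le> (\<integral>z. K * \<bar>a z\<bar> \<partial>P)"
    by (rule integral_mono) (use a integrable_norm[OF int] le in simp_all)
  finally show "norm (\<integral>z. a z *\<^sub>R k z \<partial>P) \<le> K * (\<integral>z. \<bar>a z\<bar> \<partial>P)"
    using a by simp
qed

lemma grad_eqI: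
  assumes "GDERIV f x :> D"
  shows "grad f x = D"
  unfolding grad_def
proof (rule the_equality[where a = D])
  fix D' assume "GDERIV f x :> D'"
  then have "(\<lambda>h. inner h D') = (\<lambda>h. inner h D)"
    using assms has_derivative_unique unfolding gderiv_def by blast
  then have "inner h D' = inner h D" for h
    by (rule fun_cong)
  then show "D' = D"
    using vector_eq_ldot by blast
qed (fact assms)

text \<open>Riesz representation: the derivative is the inner product with its adjoint at 1, so the
  definite description in \<open>grad\<close> denotes an actual gradient.\<close>

lemma GDERIV_grad:
  fixes f :: "'t::euclidean_space \<Rightarrow> real"
  assumes "f differentiable (at x)"
  shows "GDERIV f x :> grad f x"
proof -
  obtain f' where f': "(f has_derivative f') (at x)"
    using assms by (auto simp: differentiable_def)
  then have "f' = (\<lambda>h. inner h (adjoint f' 1))"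
    by (intro ext) (simp add: adjoint_works[OF has_derivative_linear[OF f']])
  with f' have "GDERIV f x :> adjoint f' 1"
    unfolding gderiv_def by (rule has_derivative_subst)
  then show ?thesis
    using grad_eqI[of f x] by simp
qed

text \<open>Difference quotients along a sequence, since measurability passes to sequential limits;
  this will make the cost gradient measurable.\<close>

lemma GDERIV_directional_sequence:
  fixes f :: "'t::euclidean_space \<Rightarrow> real"
  assumes "GDERIV f x :> D" and "h \<longlonglongrightarrow> 0" and "\<And>n. h n \<noteq> 0"
  shows "(\<lambda>n. (f (x + h n *\<^sub>R v) - f x) / h n) \<longlonglongrightarrow> D \<bullet> v"
proof -
  have line: "((\<lambda>s. x + s *\<^sub>R v) has_derivative (\<lambda>s. s *\<^sub>R v)) (at 0)"
    by (auto intro!: derivative_eq_intros)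
  have "(f has_derivative (\<lambda>h. inner h D)) (at (x + 0 *\<^sub>R v))"
    using assms(1) by (simp add: gderiv_def)
  from has_derivative_compose[OF line this]
  have "((\<lambda>s. f (x + s *\<^sub>R v)) has_real_derivative D \<bullet> v) (at 0)"
    by (simp add: has_field_derivative_def inner_commute mult_commute_abs)
  then have "((\<lambda>s. (f (x + s *\<^sub>R v) - f x) / s) \<longlongrightarrow> D \<bullet> v) (at 0)"
    by (simp add: DERIV_def)
  moreover have "filterlim h (at 0) sequentially"
    using assms(2,3) by (simp add: filterlim_at)
  ultimately show ?thesis
    by (rule filterlim_compose)
qed

text \<open>Mean value inequality for \<open>f\<close> minus its linearization at \<open>x\<close>:
  the ball contains the segment to \<open>y\<close>, and on it the gradient deviates by at most
  \<open>L * norm (y - x)\<close>. This yields \<open>L\<close> rather than the sharp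
  \<open>L / 2\<close>, enough for a second-order remainder.\<close>

lemma grad_linearization_error:
  fixes f :: "'t::euclidean_space \<Rightarrow> real"
  assumes "cball x (norm (y - x)) \<subseteq> S"
    and diff: "\<And>w. w \<in> S \<Longrightarrow> f differentiable (at w)"
    and lip: "\<And>w. w \<in> S \<Longrightarrow> norm (grad f w - grad f x) \<le> L * norm (w - x)" and "0 \<le> L"
  shows "\<bar>f y - f x - (y - x) \<bullet> grad f x\<bar> \<le> L * (norm (y - x))\<^sup>2"
proof -
  have "norm (f y - f x - (\<lambda>h. h \<bullet> grad f x) (y - x)) \<le> norm (y - x) * (L * norm (y - x))"
  proof (rule differentiable_bound_linearization[where S = "cball x (norm (y - x))" and f' = "\<lambda>w h. h \<bullet> grad f w"])
    fix t :: real assume "t \<in> {0..1}"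
    then show "x + t *\<^sub>R (y - x) \<in> cball x (norm (y - x))"
      by (simp add: dist_norm mult_left_le_one_le)
  next
    fix w assume w: "w \<in> cball x (norm (y - x))"
    then have "w \<in> S" using assms by auto
    then show "(f has_derivative (\<lambda>h. h \<bullet> grad f w)) (at w within cball x (norm (y - x)))"
      using GDERIV_grad[OF diff] by (auto simp: gderiv_def intro: has_derivative_at_withinI)
    have "norm (grad f w - grad f x) \<le> L * norm (w - x)"
      using lip \<open>w \<in> S\<close> .
    also have "\<dots> \<le> L * norm (y - x)"
      using w \<open>0 \<le> L\<close> by (simp add: dist_norm norm_minus_commute mult_left_mono)
    finally have le: "norm (grad f w - grad f x) \<le> L * norm (y - x)" .
    have "norm (h \<bullet> (grad f w - grad f x)) \<le> L * norm (y - x) * norm h" for h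
      using order_trans[OF Cauchy_Schwarz_ineq2[of h "grad f w - grad f x"] mult_left_mono[OF le norm_ge_zero]]
      by (simp add: mult.commute)
    then show "onorm ((\<lambda>h. h \<bullet> grad f w) - (\<lambda>h. h \<bullet> grad f x)) \<le> L * norm (y - x)"
      by (intro onorm_le) (simp add: inner_diff_right)
  qed simp
  then show ?thesis
    by (simp add: power2_eq_square algebra_simps)
qed

section \<open>Mixtures and null sets of couplings\<close>

lemma nn_integral_mixture:
  assumes [measurable]: "a \<in> borel_measurable P" "b \<in> borel_measurable P"
    and nonneg: "\<And>z. z \<in> space P \<Longrightarrow> 0 \<le> a z" "\<And>z. z \<in> space P \<Longrightarrow> 0 \<le> b z"
    and t: "0 \<le> t" "t \<le> 1"
  shows "(\<integral>\<^sup>+z. ennreal ((1 - t) * a z + t * b z) \<partial>P)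
    = ennreal (1 - t) * (\<integral>\<^sup>+z. ennreal (a z) \<partial>P) + ennreal t * (\<integral>\<^sup>+z. ennreal (b z) \<partial>P)"
proof -
  have "(\<integral>\<^sup>+z. ennreal ((1 - t) * a z + t * b z) \<partial>P)
      = (\<integral>\<^sup>+z. ennreal (1 - t) * ennreal (a z) + ennreal t * ennreal (b z) \<partial>P)"
    by (intro nn_integral_cong) (use nonneg t in \<open>simp add: ennreal_mult ennreal_plus\<close>)
  then show ?thesis
    by (simp add: nn_integral_add nn_integral_cmult)
qed

lemma couplings_mixture:
  assumes a: "a \<in> couplings M N q p" and b: "b \<in> couplings M N q p" and t: "0 \<le> t" "t \<le> 1"
  shows "(\<lambda>z. (1 - t) * a z + t * b z) \<in> couplings M N q p"
proof -
  have [measurable]: "a \<in> borel_measurable (M \<Otimes>\<^sub>M N)" "b \<in> borel_measurable (M \<Otimes>\<^sub>M N)"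
    and nonneg: "\<And>z. z \<in> space (M \<Otimes>\<^sub>M N) \<Longrightarrow> 0 \<le> a z" "\<And>z. z \<in> space (M \<Otimes>\<^sub>M N) \<Longrightarrow> 0 \<le> b z"
    using a b by (auto simp: couplings_def prob_density_def)
  have mix: "ennreal (1 - t) * e + ennreal t * e = e" for e
    using t by (simp flip: distrib_right ennreal_plus)
  have "(\<integral>\<^sup>+z. ennreal ((1 - t) * a z + t * b z) \<partial>(M \<Otimes>\<^sub>M N)) = 1"
    using a b mix[of 1] by (subst nn_integral_mixture) (use nonneg t in \<open>auto simp: couplings_def prob_density_def\<close>)
  moreover have "AE y in N. (\<integral>\<^sup>+x. ennreal ((1 - t) * a (x, y) + t * b (x, y)) \<partial>M) = ennreal (p y)"
  proof -
    have "AE y in N. (\<integral>\<^sup>+x. ennreal (a (x, y)) \<partial>M) = ennreal (p y)"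
      "AE y in N. (\<integral>\<^sup>+x. ennreal (b (x, y)) \<partial>M) = ennreal (p y)"
      using a b by (auto simp: couplings_def)
    then show ?thesis
      using AE_space
    proof eventually_elim
      case (elim y)
      then show ?case
        using nonneg t by (subst nn_integral_mixture) (auto simp: space_pair_measure mix)
    qed
  qed
  moreover have "AE x in M. (\<integral>\<^sup>+y. ennreal ((1 - t) * a (x, y) + t * b (x, y)) \<partial>N) = ennreal (q x)"
  proof -
    have "AE x in M. (\<integral>\<^sup>+y. ennreal (a (x, y)) \<partial>N) = ennreal (q x)"
      "AE x in M. (\<integral>\<^sup>+y. ennreal (b (x, y)) \<partial>N) = ennreal (q x)"
      using a b by (auto simp: couplings_def)
    then show ?thesis
      using AE_space
    proof eventually_elim
      case (elim x)
      then show ?case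
        using nonneg t by (subst nn_integral_mixture) (auto simp: space_pair_measure mix)
    qed
  qed
  ultimately show ?thesis
    using nonneg t by (simp add: couplings_def prob_density_def)
qed

text \<open>Where a marginal density vanishes, the corresponding slice of \<open>\<pi>\<close> has
  integral 0 and hence vanishes almost everywhere. The slices in \<open>y\<close> are brought to the
  order of those in \<open>x\<close> by exchanging the almost-everywhere quantifiers. This provides
  the condition on zeros of \<open>r\<close> in the entropy lemmas.\<close>

lemma (in pair_sigma_finite) coupling_absolutely_continuous:
  assumes \<pi>: "\<pi> \<in> couplings M1 M2 q p"
    and [measurable]: "q \<in> borel_measurable M1" "p \<in> borel_measurable M2"
  shows "AE z in M1 \<Otimes>\<^sub>M M2. q (fst z) * p (snd z) = 0 \<longrightarrow> \<pi> z = 0"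
proof -
  have [measurable]: "\<pi> \<in> borel_measurable (M1 \<Otimes>\<^sub>M M2)"
    and nonneg: "\<And>z. z \<in> space (M1 \<Otimes>\<^sub>M M2) \<Longrightarrow> 0 \<le> \<pi> z"
    using \<pi> by (auto simp: couplings_def prob_density_def)
  have "AE x in M1. (\<integral>\<^sup>+y. ennreal (\<pi> (x, y)) \<partial>M2) = ennreal (q x)"
    using \<pi> by (auto simp: couplings_def)
  then have 1: "AE x in M1. AE y in M2. q x = 0 \<longrightarrow> \<pi> (x, y) = 0"
    using AE_space
  proof eventually_elim
    case (elim x)
    show ?case
    proof (cases "q x = 0")
      case True
      then have "AE y in M2. ennreal (\<pi> (x, y)) = 0"
        using elim by (subst nn_integral_0_iff_AE[symmetric]) auto
      \<comment> \<open>\<open>ennreal\<close> sends negative numbers to 0, so the nonnegativity of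
        \<open>\<pi>\<close> enters here.\<close>
      then show ?thesis
        using AE_space
        by eventually_elim
          (use nonneg elim in \<open>auto simp: space_pair_measure ennreal_eq_0_iff intro: antisym\<close>)
    qed simp
  qed
  have "AE y in M2. (\<integral>\<^sup>+x. ennreal (\<pi> (x, y)) \<partial>M1) = ennreal (p y)"
    using \<pi> by (auto simp: couplings_def)
  then have "AE y in M2. AE x in M1. p y = 0 \<longrightarrow> \<pi> (x, y) = 0"
    using AE_space
  proof eventually_elim
    case (elim y)
    show ?case
    proof (cases "p y = 0")
      case True
      then have "AE x in M1. ennreal (\<pi> (x, y)) = 0"
        using elim by (subst nn_integral_0_iff_AE[symmetric]) auto
      then show ?thesis
        using AE_space
        by eventually_elim
          (use nonneg elim in \<open>auto simp: space_pair_measure ennreal_eq_0_iff intro: antisym\<close>)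
    qed simp
  qed
  then have 2: "AE x in M1. AE y in M2. p y = 0 \<longrightarrow> \<pi> (x, y) = 0"
    by (subst AE_commute) auto
  show ?thesis
  proof (rule AE_pair_measure)
    show "AE x in M1. AE y in M2. q (fst (x, y)) * p (snd (x, y)) = 0 \<longrightarrow> \<pi> (x, y) = 0"
      using 1 2
    proof eventually_elim
      case (elim x)
      then show ?case by eventually_elim auto
    qed
  qed measurable
qed

subsection \<open>The entropic transport problem\<close>

text \<open>The suprema are unfolded into bounds at each point \<open>z\<close> of the product
  space, the form in which they are integrated.\<close>

locale entropic_transport = pair_sigma_finite M N
  for M :: "'a measure" and N :: "'d::euclidean_space measure" +
  fixes q :: "'a \<Rightarrow> real" and p :: "'d \<Rightarrow> real"
    and \<Theta> :: "'t::euclidean_space set"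
    and G :: "'t \<Rightarrow> 'a \<Rightarrow> 'd" and c :: "'d \<Rightarrow> 'd \<Rightarrow> real"
    and lam L0 L1 :: real
  assumes q: "prob_density M q" and p: "prob_density N p" and open_\<Theta>: "open \<Theta>"
    and lam_pos: "0 < lam" and L0_nonneg: "0 \<le> L0" and L1_nonneg: "0 \<le> L1"
    and cost_measurable: "\<And>\<theta>. \<theta> \<in> \<Theta> \<Longrightarrow> (\<lambda>z. c (G \<theta> (fst z)) (snd z)) \<in> borel_measurable (M \<Otimes>\<^sub>M N)"
    and cost_differentiable: "\<And>z \<theta>. z \<in> space (M \<Otimes>\<^sub>M N) \<Longrightarrow> \<theta> \<in> \<Theta> \<Longrightarrow>
      (\<lambda>\<theta>. c (G \<theta> (fst z)) (snd z)) differentiable (at \<theta>)"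
    and plan_exists: "\<And>\<theta>. \<theta> \<in> \<Theta> \<Longrightarrow>
      \<exists>\<pi>. OT_plan M N q p c G lam \<theta> \<pi> \<and> \<bar>OT_objective M N q p c G lam \<pi> \<theta>\<bar> \<noteq> \<infinity>"
    and grad_cost_lipschitz: "\<And>z \<theta>1 \<theta>2. z \<in> space (M \<Otimes>\<^sub>M N) \<Longrightarrow> \<theta>1 \<in> \<Theta> \<Longrightarrow> \<theta>2 \<in> \<Theta> \<Longrightarrow>
      norm (grad (\<lambda>\<theta>. c (G \<theta> (fst z)) (snd z)) \<theta>1 - grad (\<lambda>\<theta>. c (G \<theta> (fst z)) (snd z)) \<theta>2)
      \<le> L1 * norm (\<theta>1 - \<theta>2)"
    and grad_cost_bounded: "\<And>z \<theta>. z \<in> space (M \<Otimes>\<^sub>M N) \<Longrightarrow> \<theta> \<in> \<Theta> \<Longrightarrow>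
      norm (grad (\<lambda>\<theta>. c (G \<theta> (fst z)) (snd z)) \<theta>) \<le> L0"
    and cost_lipschitz: "\<And>z \<theta>1 \<theta>2. z \<in> space (M \<Otimes>\<^sub>M N) \<Longrightarrow> \<theta>1 \<in> \<Theta> \<Longrightarrow> \<theta>2 \<in> \<Theta> \<Longrightarrow>
      \<bar>c (G \<theta>1 (fst z)) (snd z) - c (G \<theta>2 (fst z)) (snd z)\<bar> \<le> L0 * norm (\<theta>1 - \<theta>2)"
begin

abbreviation P :: "('a \<times> 'd) measure" where "P \<equiv> M \<Otimes>\<^sub>M N"

definition cost :: "'t \<Rightarrow> 'a \<times> 'd \<Rightarrow> real" where
  "cost \<theta> z = c (G \<theta> (fst z)) (snd z)"

definition grad_cost :: "'t \<Rightarrow> 'a \<times> 'd \<Rightarrow> 't" where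
  "grad_cost \<theta> z = grad (\<lambda>\<theta>. cost \<theta> z) \<theta>"

definition entropy :: "('a \<times> 'd \<Rightarrow> real) \<Rightarrow> 'a \<times> 'd \<Rightarrow> real" where
  "entropy \<pi> z = \<pi> z * ln (\<pi> z / (q (fst z) * p (snd z)))"

text \<open>The couplings on which extended-real and Bochner integrals agree, at all parameters
  simultaneously, so that one plan can be compared at two parameters.\<close>

definition admissible :: "('a \<times> 'd \<Rightarrow> real) \<Rightarrow> bool" where
  "admissible \<pi> \<longleftrightarrow> \<pi> \<in> couplings M N q p \<and> integrable P (entropy \<pi>) \<and>
     (\<forall>\<theta>\<in>\<Theta>. integrable P (\<lambda>z. \<pi> z * cost \<theta> z))"

text \<open>Real-valued form of \<open>OT_objective\<close>, meant for \<open>admissible\<close>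
  couplings; a non-integrable term would count as 0.\<close>

definition objective :: "('a \<times> 'd \<Rightarrow> real) \<Rightarrow> 't \<Rightarrow> real" where
  "objective \<pi> \<theta> = (\<integral>z. \<pi> z * cost \<theta> z \<partial>P) + lam * (\<integral>z. entropy \<pi> z \<partial>P)"

abbreviation plan :: "'t \<Rightarrow> ('a \<times> 'd \<Rightarrow> real) \<Rightarrow> bool" where
  "plan \<equiv> OT_plan M N q p c G lam"

abbreviation opt_value :: "'t \<Rightarrow> real" where
  "opt_value \<equiv> OT_value M N q p c G lam"

section \<open>Reduction to a finite, real-valued objective\<close>

lemma densities_measurable [measurable]: "q \<in> borel_measurable M" "p \<in> borel_measurable N"
  using q p by (auto simp: prob_density_def)

lemma measurable_cost: "\<theta> \<in> \<Theta> \<Longrightarrow> cost \<theta> \<in> borel_measurable P"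
  using cost_measurable by (simp add: cost_def[abs_def])

lemma couplings_measurable: "\<pi> \<in> couplings M N q p \<Longrightarrow> \<pi> \<in> borel_measurable P"
  by (simp add: couplings_def prob_density_def)

lemma couplings_integrable:
  assumes "\<pi> \<in> couplings M N q p"
  shows "integrable P \<pi>" "integral\<^sup>L P \<pi> = 1"
  using assms prob_density_integrable by (auto simp: couplings_def)

lemma couplings_nonneg: "\<pi> \<in> couplings M N q p \<Longrightarrow> z \<in> space P \<Longrightarrow> 0 \<le> \<pi> z"
  by (simp add: couplings_def prob_density_def)

lemma OT_objective_eq:
  "OT_objective M N q p c G lam \<pi> \<theta>
    = ext_integral P (\<lambda>z. \<pi> z * cost \<theta> z) + ereal lam * ext_integral P (entropy \<pi>)"
  by (simp add: OT_objective_def KL_reg_def cost_def entropy_def[abs_def] case_prod_beta')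

lemma OT_objective_admissible:
  assumes "admissible \<pi>" "\<theta> \<in> \<Theta>"
  shows "OT_objective M N q p c G lam \<pi> \<theta> = ereal (objective \<pi> \<theta>)"
  using assms by (simp add: OT_objective_eq admissible_def ext_integral_eq objective_def)

lemma integrable_cost_difference:
  assumes "integrable P a" "\<theta>1 \<in> \<Theta>" "\<theta>2 \<in> \<Theta>"
  shows "integrable P (\<lambda>z. a z * (cost \<theta>1 z - cost \<theta>2 z))"
    and "\<bar>\<integral>z. a z * (cost \<theta>1 z - cost \<theta>2 z) \<partial>P\<bar> \<le> L0 * norm (\<theta>1 - \<theta>2) * (\<integral>z. \<bar>a z\<bar> \<partial>P)"
proof -
  have meas: "(\<lambda>z. cost \<theta>1 z - cost \<theta>2 z) \<in> borel_measurable P"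
    using assms measurable_cost by simp
  have bound: "norm (cost \<theta>1 z - cost \<theta>2 z) \<le> L0 * norm (\<theta>1 - \<theta>2)" if "z \<in> space P" for z
    using cost_lipschitz[OF that] assms by (simp add: cost_def)
  show "integrable P (\<lambda>z. a z * (cost \<theta>1 z - cost \<theta>2 z))"
    "\<bar>\<integral>z. a z * (cost \<theta>1 z - cost \<theta>2 z) \<partial>P\<bar> \<le> L0 * norm (\<theta>1 - \<theta>2) * (\<integral>z. \<bar>a z\<bar> \<partial>P)"
    using norm_integral_scaleR_le[OF assms(1) meas bound] by simp_all
qed

lemma admissible_if_finite:
  assumes \<pi>: "\<pi> \<in> couplings M N q p" and \<theta>: "\<theta> \<in> \<Theta>"
    and finite: "\<bar>OT_objective M N q p c G lam \<pi> \<theta>\<bar> \<noteq> \<infinity>"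
  shows "admissible \<pi>"
proof -
  note [measurable] = couplings_measurable[OF \<pi>] measurable_cost[OF \<theta>]
  let ?C = "ext_integral P (\<lambda>z. \<pi> z * cost \<theta> z)" and ?E = "ext_integral P (entropy \<pi>)"
  \<comment> \<open>As \<open>lam\<close> is positive, scaling keeps infinite values infinite, and a
    sum with an infinite summand is infinite in ereal, even \<infinity> - \<infinity>.\<close>
  have summands: "\<bar>x\<bar> \<noteq> \<infinity> \<and> \<bar>y\<bar> \<noteq> \<infinity>" if "\<bar>x + ereal lam * y\<bar> \<noteq> \<infinity>" for x y :: ereal
    using that lam_pos by (cases x; cases y) auto
  have "\<bar>?C\<bar> \<noteq> \<infinity>" "\<bar>?E\<bar> \<noteq> \<infinity>"
    using summands[OF finite[unfolded OT_objective_eq]] by simp_all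
  moreover have "(\<lambda>z. \<pi> z * cost \<theta> z) \<in> borel_measurable P" "entropy \<pi> \<in> borel_measurable P"
    unfolding entropy_def[abs_def] by measurable
  ultimately have int: "integrable P (\<lambda>z. \<pi> z * cost \<theta> z)" "integrable P (entropy \<pi>)"
    by (simp_all add: integrable_if_ext_integral_finite)
  \<comment> \<open>Integrability at one parameter spreads to all others because the two costs
    differ by a bounded function.\<close>
  have "integrable P (\<lambda>z. \<pi> z * cost \<theta>' z)" if "\<theta>' \<in> \<Theta>" for \<theta>'
  proof -
    have "integrable P (\<lambda>z. \<pi> z * cost \<theta> z + \<pi> z * (cost \<theta>' z - cost \<theta> z))"
      using int(1) integrable_cost_difference(1)[OF couplings_integrable(1)[OF \<pi>] that \<theta>] by simp
    then show ?thesis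
      by (simp add: right_diff_distrib)
  qed
  with int \<pi> show ?thesis
    by (simp add: admissible_def)
qed

lemma plan_le:
  assumes "plan \<theta> \<pi>" "\<pi>' \<in> couplings M N q p"
  shows "OT_objective M N q p c G lam \<pi> \<theta> \<le> OT_objective M N q p c G lam \<pi>' \<theta>"
  using assms unfolding OT_plan_def is_arg_min_linorder by blast

lemma plan_coupling: "plan \<theta> \<pi> \<Longrightarrow> \<pi> \<in> couplings M N q p"
  by (simp add: OT_plan_def is_arg_min_def)

text \<open>Existence provides one minimizer of finite value; all minimizers share that value, so
  each of them is admissible.\<close>

lemma plan_admissible:
  assumes "\<theta> \<in> \<Theta>" "plan \<theta> \<pi>"
  shows "admissible \<pi>"
proof -
  from plan_exists[OF assms(1)] obtain \<pi>' where
    \<pi>': "plan \<theta> \<pi>'" "\<bar>OT_objective M N q p c G lam \<pi>' \<theta>\<bar> \<noteq> \<infinity>"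
    by (elim exE conjE)
  have eq: "OT_objective M N q p c G lam \<pi> \<theta> = OT_objective M N q p c G lam \<pi>' \<theta>"
    using plan_le[OF assms(2) plan_coupling[OF \<pi>'(1)]] plan_le[OF \<pi>'(1) plan_coupling[OF assms(2)]]
    by (rule antisym)
  show ?thesis
    by (rule admissible_if_finite[OF plan_coupling[OF assms(2)] assms(1)]) (unfold eq, rule \<pi>'(2))
qed

lemma opt_value_eq:
  assumes "\<theta> \<in> \<Theta>" "plan \<theta> \<pi>"
  shows "opt_value \<theta> = objective \<pi> \<theta>"
proof -
  have "(INF \<pi>\<in>couplings M N q p. OT_objective M N q p c G lam \<pi> \<theta>) = OT_objective M N q p c G lam \<pi> \<theta>"
    using plan_le[OF assms(2)] plan_coupling[OF assms(2)] by (intro antisym INF_lower INF_greatest)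
  then show ?thesis
    using OT_objective_admissible[OF plan_admissible[OF assms] assms(1)] by (simp add: OT_value_def)
qed

lemma objective_plan_le:
  assumes "\<theta> \<in> \<Theta>" "plan \<theta> \<pi>" "admissible \<pi>'"
  shows "objective \<pi> \<theta> \<le> objective \<pi>' \<theta>"
  using plan_le[OF assms(2), of \<pi>'] assms plan_admissible
  by (simp add: OT_objective_admissible admissible_def[of \<pi>'])

section \<open>Quadratic growth and stability of optimal plans\<close>

text \<open>The cost term is linear in the plan, so all curvature comes from \<open>lam\<close>
  times the entropy. Admissibility of the mixture lets it compete with an optimal plan.\<close>

lemma objective_strongly_convex:
  assumes a: "admissible a" and b: "admissible b" and t: "0 < t" "t < 1" and \<theta>: "\<theta> \<in> \<Theta>"
  defines "m \<equiv> \<lambda>z. (1 - t) * a z + t * b z"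
  shows "admissible m"
    and "objective m \<theta> \<le> (1 - t) * objective a \<theta> + t * objective b \<theta>
      - lam * (t * (1 - t) / 2 * (\<integral>z. \<bar>a z - b z\<bar> \<partial>P)\<^sup>2)"
proof -
  note ca = couplings_integrable[of a] and cb = couplings_integrable[of b]
  have C: "a \<in> couplings M N q p" "b \<in> couplings M N q p"
    using a b by (auto simp: admissible_def)
  have AE: "AE z in P. 0 \<le> a z \<and> 0 \<le> b z \<and> 0 \<le> q (fst z) * p (snd z)
      \<and> (q (fst z) * p (snd z) = 0 \<longrightarrow> a z = 0 \<and> b z = 0)"
    using coupling_absolutely_continuous[OF C(1) densities_measurable]
      coupling_absolutely_continuous[OF C(2) densities_measurable] AE_space
  proof eventually_elim
    case (elim z)
    then show ?case
      using C[THEN couplings_nonneg] q p by (auto simp: prob_density_def space_pair_measure)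
  qed
  have entropy: "integrable P (entropy m)" "(\<integral>z. entropy m z \<partial>P)
      \<le> (1 - t) * (\<integral>z. entropy a z \<partial>P) + t * (\<integral>z. entropy b z \<partial>P)
        - t * (1 - t) / 2 * (\<integral>z. \<bar>a z - b z\<bar> \<partial>P)\<^sup>2"
    using entropy_strongly_convex[OF ca[OF C(1)] cb[OF C(2)] _ AE _ _ t] a b
    by (simp_all add: entropy_def[abs_def] m_def admissible_def)
  have cost: "integrable P (\<lambda>z. m z * cost \<theta>' z)" "(\<integral>z. m z * cost \<theta>' z \<partial>P)
      = (1 - t) * (\<integral>z. a z * cost \<theta>' z \<partial>P) + t * (\<integral>z. b z * cost \<theta>' z \<partial>P)" if "\<theta>' \<in> \<Theta>" for \<theta>'
    using a b that by (simp_all add: admissible_def m_def distrib_right mult.assoc)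
  show "admissible m"
    using couplings_mixture[OF C, of t] entropy cost t by (simp add: admissible_def m_def)
  have "lam * (\<integral>z. entropy m z \<partial>P)
      \<le> lam * ((1 - t) * (\<integral>z. entropy a z \<partial>P) + t * (\<integral>z. entropy b z \<partial>P)
        - t * (1 - t) / 2 * (\<integral>z. \<bar>a z - b z\<bar> \<partial>P)\<^sup>2)"
    using entropy(2) lam_pos by (intro mult_left_mono) auto
  then show "objective m \<theta> \<le> (1 - t) * objective a \<theta> + t * objective b \<theta>
      - lam * (t * (1 - t) / 2 * (\<integral>z. \<bar>a z - b z\<bar> \<partial>P)\<^sup>2)"
    using cost(2)[OF \<theta>] by (simp add: objective_def algebra_simps)
qed

lemma plan_quadratic_growth:
  assumes \<theta>: "\<theta> \<in> \<Theta>" and a: "plan \<theta> a" and b: "admissible b"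
  shows "objective a \<theta> + lam / 2 * (\<integral>z. \<bar>a z - b z\<bar> \<partial>P)\<^sup>2 \<le> objective b \<theta>"
proof -
  define D where "D = (\<integral>z. \<bar>a z - b z\<bar> \<partial>P)"
  have "lam / 2 * D\<^sup>2 \<le> objective b \<theta> - objective a \<theta>"
  \<comment> \<open>Minimality of \<open>a\<close> against the mixture with weight \<open>t\<close>
    on \<open>b\<close>, divided by \<open>t\<close>, gives the bound with a factor
    \<open>1 - t\<close>. This rule replaces the limit as \<open>t\<close> tends to 0.\<close>
  proof (rule field_le_mult_one_interval)
    fix s :: real assume s: "0 < s" "s < 1"
    define t where "t = 1 - s"
    have t: "0 < t" "t < 1" "s = 1 - t"
      using s by (auto simp: t_def)
    have "objective a \<theta> \<le> (1 - t) * objective a \<theta> + t * objective b \<theta> - lam * (t * (1 - t) / 2 * D\<^sup>2)"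
      unfolding D_def
      by (rule order_trans[OF objective_plan_le objective_strongly_convex(2)])
        (use plan_admissible objective_strongly_convex(1) \<theta> a b t in auto)
    then have "t * (s * (lam / 2 * D\<^sup>2)) \<le> t * (objective b \<theta> - objective a \<theta>)"
      unfolding t(3) by (simp add: algebra_simps)
    then show "s * (lam / 2 * D\<^sup>2) \<le> objective b \<theta> - objective a \<theta>"
      using t by simp
  qed
  then show ?thesis
    by (simp add: D_def)
qed

lemma objective_diff:
  assumes "admissible \<pi>" "\<theta>1 \<in> \<Theta>" "\<theta>2 \<in> \<Theta>"
  shows "objective \<pi> \<theta>1 - objective \<pi> \<theta>2 = (\<integral>z. \<pi> z * (cost \<theta>1 z - cost \<theta>2 z) \<partial>P)"
  using assms by (simp add: admissible_def objective_def right_diff_distrib)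

text \<open>The two growth bounds contribute \<open>lam / 2\<close> each. The resulting
  \<open>lam * D\<^sup>2\<close> is bounded by a pairing of \<open>b - a\<close> with the cost
  difference, itself linear in \<open>D\<close>, so one factor \<open>D\<close> cancels. The case
  \<open>\<theta>1 = \<theta>2\<close> is uniqueness of the plan up to null sets.\<close>

lemma plan_lipschitz:
  assumes \<theta>: "\<theta>1 \<in> \<Theta>" "\<theta>2 \<in> \<Theta>" and plans: "plan \<theta>1 a" "plan \<theta>2 b"
  shows "(\<integral>z. \<bar>a z - b z\<bar> \<partial>P) \<le> L0 / lam * norm (\<theta>1 - \<theta>2)"
proof -
  define D where "D = (\<integral>z. \<bar>a z - b z\<bar> \<partial>P)"
  have adm: "admissible a" "admissible b"
    using plan_admissible \<theta> plans by auto
  then have [simp]: "integrable P a" "integrable P b"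
    by (auto simp: admissible_def couplings_integrable)
  have "objective a \<theta>1 + lam / 2 * D\<^sup>2 \<le> objective b \<theta>1"
    unfolding D_def by (rule plan_quadratic_growth) (use \<theta> plans adm in auto)
  moreover have "objective b \<theta>2 + lam / 2 * D\<^sup>2 \<le> objective a \<theta>2"
    using plan_quadratic_growth[OF \<theta>(2) plans(2) adm(1)]
    by (simp add: D_def abs_minus_commute)
  ultimately have "lam * D\<^sup>2 \<le> (objective b \<theta>1 - objective b \<theta>2) - (objective a \<theta>1 - objective a \<theta>2)"
    by linarith
  also have "\<dots> = (\<integral>z. b z * (cost \<theta>1 z - cost \<theta>2 z) \<partial>P) - (\<integral>z. a z * (cost \<theta>1 z - cost \<theta>2 z) \<partial>P)"
    using objective_diff adm \<theta> by simp
  also have "\<dots> = (\<integral>z. (b z - a z) * (cost \<theta>1 z - cost \<theta>2 z) \<partial>P)"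
    using integrable_cost_difference(1)[OF _ \<theta>] by (simp add: left_diff_distrib)
  also have "\<dots> \<le> L0 * norm (\<theta>1 - \<theta>2) * D"
    using integrable_cost_difference(2)[OF _ \<theta>, of "\<lambda>z. b z - a z"]
    by (simp add: D_def abs_minus_commute)
  finally have *: "lam * D * D \<le> L0 * norm (\<theta>1 - \<theta>2) * D"
    by (simp add: power2_eq_square)
  have "lam * D \<le> L0 * norm (\<theta>1 - \<theta>2)"
  proof (cases "D = 0")
    case False
    then have "0 < D" by (simp add: D_def less_le)
    with * show ?thesis by simp
  qed (use L0_nonneg in simp)
  then show ?thesis
    using lam_pos by (simp add: D_def field_simps)
qed

subsection \<open>The envelope formula\<close>

text \<open>Each coordinate of the gradient is a pointwise limit of difference quotients of
  measurable costs.\<close>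

lemma grad_cost_measurable:
  assumes "\<theta> \<in> \<Theta>"
  shows "grad_cost \<theta> \<in> borel_measurable P"
proof (subst borel_measurable_euclidean_space, intro ballI)
  fix i :: 't assume i: "i \<in> Basis"
  obtain e where e: "0 < e" "ball \<theta> e \<subseteq> \<Theta>"
    using open_\<Theta> assms open_contains_ball by blast
  \<comment> \<open>The offset 2 makes already \<open>h 0\<close> strictly smaller than
    \<open>e\<close>, so every shifted parameter stays in the open ball.\<close>
  define h where "h n = e / (real n + 2)" for n :: nat
  have h0: "h n \<noteq> 0" for n
    using e by (simp add: h_def)
  have "h \<longlonglongrightarrow> 0"
    unfolding h_def using LIMSEQ_ignore_initial_segment[OF tendsto_mult_right[OF LIMSEQ_inverse_real_of_nat, of e], of 1] by (simp add: field_simps)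
  have "\<theta> + h n *\<^sub>R i \<in> \<Theta>" for n
  proof -
    have "e / (real n + 2) < e"
      using e by (simp add: field_simps add_pos_nonneg)
    then have "\<theta> + h n *\<^sub>R i \<in> ball \<theta> e"
      using e i by (simp add: dist_norm h_def)
    then show ?thesis using e by blast
  qed
  then have meas: "(\<lambda>z. (cost (\<theta> + h n *\<^sub>R i) z - cost \<theta> z) / h n) \<in> borel_measurable P" for n
    using measurable_cost assms by simp
  show "(\<lambda>z. grad_cost \<theta> z \<bullet> i) \<in> borel_measurable P"
  proof (rule borel_measurable_LIMSEQ_real[OF _ meas])
    fix z assume "z \<in> space P"
    then have "GDERIV (\<lambda>\<theta>. cost \<theta> z) \<theta> :> grad_cost \<theta> z"
      unfolding grad_cost_def cost_def using assms by (intro GDERIV_grad cost_differentiable)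
    then show "(\<lambda>n. (cost (\<theta> + h n *\<^sub>R i) z - cost \<theta> z) / h n) \<longlonglongrightarrow> grad_cost \<theta> z \<bullet> i"
      using \<open>h \<longlonglongrightarrow> 0\<close> h0 by (rule GDERIV_directional_sequence)
  qed
qed

lemma cost_linearization_error:
  assumes "\<theta> \<in> \<Theta>" "cball \<theta> (norm (\<theta>' - \<theta>)) \<subseteq> \<Theta>" "z \<in> space P"
  shows "\<bar>cost \<theta>' z - cost \<theta> z - (\<theta>' - \<theta>) \<bullet> grad_cost \<theta> z\<bar> \<le> L1 * (norm (\<theta>' - \<theta>))\<^sup>2"
  unfolding grad_cost_def
proof (rule grad_linearization_error[OF assms(2)])
  fix w assume "w \<in> \<Theta>"
  then show "(\<lambda>\<theta>. cost \<theta> z) differentiable at w"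
    unfolding cost_def using cost_differentiable assms by blast
  show "norm (grad (\<lambda>\<theta>. cost \<theta> z) w - grad (\<lambda>\<theta>. cost \<theta> z) \<theta>) \<le> L1 * norm (w - \<theta>)"
    unfolding cost_def using grad_cost_lipschitz assms \<open>w \<in> \<Theta>\<close> by blast
qed (fact L1_nonneg)

lemma integrable_grad_cost:
  assumes "integrable P a" "\<theta> \<in> \<Theta>"
  shows "integrable P (\<lambda>z. a z *\<^sub>R grad_cost \<theta> z)"
    and "norm (\<integral>z. a z *\<^sub>R grad_cost \<theta> z \<partial>P) \<le> L0 * (\<integral>z. \<bar>a z\<bar> \<partial>P)"
  using norm_integral_scaleR_le[OF assms(1) grad_cost_measurable[OF assms(2)], of L0]
    grad_cost_bounded[OF _ assms(2)] by (simp_all add: grad_cost_def cost_def)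

lemma couplings_abs_integral:
  assumes "\<pi> \<in> couplings M N q p"
  shows "(\<integral>z. \<bar>\<pi> z\<bar> \<partial>P) = 1"
proof -
  have "(\<integral>z. \<bar>\<pi> z\<bar> \<partial>P) = integral\<^sup>L P \<pi>"
    by (rule Bochner_Integration.integral_cong) (simp_all add: couplings_nonneg[OF assms])
  then show ?thesis
    using couplings_integrable(2)[OF assms] by simp
qed

lemma opt_value_linearization_error:
  assumes \<theta>: "\<theta> \<in> \<Theta>" and a: "plan \<theta> a" and seg: "cball \<theta> (norm (\<theta>' - \<theta>)) \<subseteq> \<Theta>"
  shows "\<bar>opt_value \<theta>' - opt_value \<theta> - (\<theta>' - \<theta>) \<bullet> (\<integral>z. a z *\<^sub>R grad_cost \<theta> z \<partial>P)\<bar>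
    \<le> (L1 + L0\<^sup>2 / lam) * (norm (\<theta>' - \<theta>))\<^sup>2"
proof -
  have "\<theta>' \<in> cball \<theta> (norm (\<theta>' - \<theta>))"
    by (simp add: dist_norm norm_minus_commute)
  then have \<theta>': "\<theta>' \<in> \<Theta>"
    using seg by blast
  obtain b where b: "plan \<theta>' b"
    using plan_exists[OF \<theta>'] by (elim exE conjE)
  have adm: "admissible a" "admissible b"
    using plan_admissible[OF \<theta> a] plan_admissible[OF \<theta>' b] by auto
  have int: "integrable P a" "integrable P b" and abs_a: "(\<integral>z. \<bar>a z\<bar> \<partial>P) = 1"
    using plan_coupling[OF a] plan_coupling[OF b]
    by (simp_all add: couplings_integrable couplings_abs_integral)
  \<comment> \<open>\<open>I\<close> is the change of the objective with the plan \<open>a\<close>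
    frozen; \<open>J\<close> is the correction for exchanging \<open>a\<close> for
    \<open>b\<close>.\<close>
  define I where "I = (\<integral>z. a z * (cost \<theta>' z - cost \<theta> z) \<partial>P)"
  define J where "J = (\<integral>z. (b z - a z) * (cost \<theta>' z - cost \<theta> z) \<partial>P)"
  define W where "W = (\<integral>z. a z *\<^sub>R grad_cost \<theta> z \<partial>P)"
  note intI = integrable_cost_difference(1)[OF _ \<theta>' \<theta>]
  have linear: "\<bar>I - (\<theta>' - \<theta>) \<bullet> W\<bar> \<le> L1 * (norm (\<theta>' - \<theta>))\<^sup>2"
  proof -
    have meas: "(\<lambda>z. cost \<theta>' z - cost \<theta> z - (\<theta>' - \<theta>) \<bullet> grad_cost \<theta> z) \<in> borel_measurable P"
      using measurable_cost[OF \<theta>] measurable_cost[OF \<theta>'] grad_cost_measurable[OF \<theta>] by simp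
    have "(\<integral>z. a z * (cost \<theta>' z - cost \<theta> z - (\<theta>' - \<theta>) \<bullet> grad_cost \<theta> z) \<partial>P)
        = (\<integral>z. a z * (cost \<theta>' z - cost \<theta> z) - (\<theta>' - \<theta>) \<bullet> (a z *\<^sub>R grad_cost \<theta> z) \<partial>P)"
      by (simp add: right_diff_distrib)
    \<comment> \<open>The scalar \<open>a z\<close> stays inside the inner product, so that the
      constant vector can be pulled out of the integral.\<close>
    also have "\<dots> = I - (\<theta>' - \<theta>) \<bullet> W"
      unfolding I_def W_def
      using intI[OF int(1)] integrable_grad_cost(1)[OF int(1) \<theta>]
      by (subst Bochner_Integration.integral_diff) (auto simp del: inner_scaleR_right)
    finally show ?thesis
      using norm_integral_scaleR_le(2)[OF int(1) meas, of "L1 * (norm (\<theta>' - \<theta>))\<^sup>2"]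
        cost_linearization_error[OF \<theta> seg] abs_a by simp
  qed
  \<comment> \<open>Second order: both the cost difference and the distance of the plans are of
    order \<open>norm (\<theta>' - \<theta>)\<close>.\<close>
  have J: "\<bar>J\<bar> \<le> L0\<^sup>2 / lam * (norm (\<theta>' - \<theta>))\<^sup>2"
  proof -
    have "\<bar>J\<bar> \<le> L0 * norm (\<theta>' - \<theta>) * (\<integral>z. \<bar>b z - a z\<bar> \<partial>P)"
      unfolding J_def using int by (intro integrable_cost_difference \<theta> \<theta>') simp
    also have "\<dots> \<le> L0 * norm (\<theta>' - \<theta>) * (L0 / lam * norm (\<theta>' - \<theta>))"
      by (intro mult_left_mono plan_lipschitz \<theta> \<theta>' a b) (simp add: L0_nonneg)
    finally show ?thesis
      by (simp add: power2_eq_square algebra_simps)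
  qed
  have opt_values: "opt_value \<theta> = objective a \<theta>" "opt_value \<theta>' = objective b \<theta>'"
    using opt_value_eq[OF \<theta> a] opt_value_eq[OF \<theta>' b] .
  \<comment> \<open>Here \<open>a\<close> competes at \<open>\<theta>'\<close>; for the lower bound,
    \<open>b\<close> competes at \<open>\<theta>\<close>.\<close>
  have upper: "opt_value \<theta>' - opt_value \<theta> \<le> I"
    using objective_plan_le[OF \<theta>' b adm(1)] objective_diff[OF adm(1) \<theta>' \<theta>] opt_values by (simp add: I_def)
  have "I + J = (\<integral>z. b z * (cost \<theta>' z - cost \<theta> z) \<partial>P)"
    unfolding I_def J_def using intI[OF int(1)] intI[OF int(2)] by (simp add: left_diff_distrib)
  then have lower: "I + J \<le> opt_value \<theta>' - opt_value \<theta>"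
    using objective_plan_le[OF \<theta> a adm(2)] objective_diff[OF adm(2) \<theta>' \<theta>] opt_values by simp
  show ?thesis
    using linear J upper lower unfolding W_def[symmetric] distrib_right by linarith
qed

lemma GDERIV_opt_value:
  assumes \<theta>: "\<theta> \<in> \<Theta>" and a: "plan \<theta> a"
  shows "GDERIV opt_value \<theta> :> (\<integral>z. a z *\<^sub>R grad_cost \<theta> z \<partial>P)"
proof -
  define K where "K = L1 + L0\<^sup>2 / lam"
  obtain e where e: "0 < e" "ball \<theta> e \<subseteq> \<Theta>"
    using open_\<Theta> \<theta> open_contains_ball by blast
  show ?thesis
    unfolding gderiv_def
  \<comment> \<open>Dividing the quadratic remainder by \<open>norm (y - \<theta>)\<close> leaves a
    bound that still tends to 0.\<close>
  proof (rule has_derivativeI_sandwich[OF e(1), where H = "\<lambda>y. K * norm (y - \<theta>)"])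
    show "bounded_linear (\<lambda>h. h \<bullet> (\<integral>z. a z *\<^sub>R grad_cost \<theta> z \<partial>P))"
      by (rule bounded_linear_inner_left)
    have "((\<lambda>y. K * norm (y - \<theta>)) \<longlongrightarrow> K * norm (\<theta> - \<theta>)) (at \<theta>)"
      by (intro tendsto_intros)
    then show "((\<lambda>y. K * norm (y - \<theta>)) \<longlongrightarrow> 0) (at \<theta>)"
      by simp
    fix y assume y: "y \<noteq> \<theta>" "dist y \<theta> < e"
    then have "cball \<theta> (norm (y - \<theta>)) \<subseteq> \<Theta>"
      using e(2) by (auto simp: dist_norm norm_minus_commute subset_iff)
    from opt_value_linearization_error[OF \<theta> a this]
    show "norm (opt_value y - opt_value \<theta> - (y - \<theta>) \<bullet> (\<integral>z. a z *\<^sub>R grad_cost \<theta> z \<partial>P)) / norm (y - \<theta>)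
        \<le> K * norm (y - \<theta>)"
      using y by (simp add: K_def power2_eq_square pos_divide_le_eq mult.assoc)
  qed
qed

text \<open>By the envelope formula the gradients are integrals against any optimal plans
  \<open>a\<close> and \<open>b\<close>. Changing the cost gradient under the fixed plan
  \<open>a\<close> of mass 1 contributes \<open>L1\<close>; then changing the plan contributes
  \<open>L0\<close> times its Lipschitz constant \<open>L0 / lam\<close>.\<close>

lemma opt_value_lipschitz_smooth: "lipschitz_smooth_on \<Theta> (L1 + L0\<^sup>2 / lam) opt_value"
proof -
  have "dist (grad opt_value \<theta>1) (grad opt_value \<theta>2) \<le> (L1 + L0\<^sup>2 / lam) * dist \<theta>1 \<theta>2"
    if \<theta>: "\<theta>1 \<in> \<Theta>" "\<theta>2 \<in> \<Theta>" for \<theta>1 \<theta>2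
  proof -
    obtain a b where plans: "plan \<theta>1 a" "plan \<theta>2 b"
      using plan_exists[OF \<theta>(1)] plan_exists[OF \<theta>(2)] by (elim exE conjE)
    have int: "integrable P a" "integrable P b" and abs_a: "(\<integral>z. \<bar>a z\<bar> \<partial>P) = 1"
      using plan_coupling[OF plans(1)] plan_coupling[OF plans(2)]
      by (simp_all add: couplings_integrable couplings_abs_integral)
    let ?g1 = "grad_cost \<theta>1" and ?g2 = "grad_cost \<theta>2"
    have meas: "(\<lambda>z. ?g1 z - ?g2 z) \<in> borel_measurable P"
      using grad_cost_measurable \<theta> by simp
    have bound: "norm (?g1 z - ?g2 z) \<le> L1 * norm (\<theta>1 - \<theta>2)" if "z \<in> space P" for z
      using grad_cost_lipschitz[OF that \<theta>] by (simp add: grad_cost_def cost_def)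
    have "(\<integral>z. a z *\<^sub>R ?g1 z \<partial>P) - (\<integral>z. b z *\<^sub>R ?g2 z \<partial>P)
        = (\<integral>z. a z *\<^sub>R (?g1 z - ?g2 z) \<partial>P) + (\<integral>z. (a z - b z) *\<^sub>R ?g2 z \<partial>P)"
      using integrable_grad_cost(1)[OF int(1) \<theta>(1)] integrable_grad_cost(1)[OF int(1) \<theta>(2)]
        integrable_grad_cost(1)[OF int(2) \<theta>(2)]
      by (simp add: scaleR_diff_left scaleR_diff_right)
    also have "norm \<dots> \<le> L1 * norm (\<theta>1 - \<theta>2) + L0 * (L0 / lam * norm (\<theta>1 - \<theta>2))"
    proof (rule norm_triangle_mono)
      show "norm (\<integral>z. a z *\<^sub>R (?g1 z - ?g2 z) \<partial>P) \<le> L1 * norm (\<theta>1 - \<theta>2)"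
        using norm_integral_scaleR_le(2)[OF int(1) meas bound] abs_a by simp
      have "norm (\<integral>z. (a z - b z) *\<^sub>R ?g2 z \<partial>P) \<le> L0 * (\<integral>z. \<bar>a z - b z\<bar> \<partial>P)"
        using int by (intro integrable_grad_cost \<theta>) simp
      also have "\<dots> \<le> L0 * (L0 / lam * norm (\<theta>1 - \<theta>2))"
        by (intro mult_left_mono plan_lipschitz \<theta> plans L0_nonneg)
      finally show "norm (\<integral>z. (a z - b z) *\<^sub>R ?g2 z \<partial>P) \<le> L0 * (L0 / lam * norm (\<theta>1 - \<theta>2))" .
    qed
    finally show ?thesis
      using grad_eqI[OF GDERIV_opt_value[OF \<theta>(1) plans(1)]] grad_eqI[OF GDERIV_opt_value[OF \<theta>(2) plans(2)]]
      by (simp add: dist_norm power2_eq_square algebra_simps)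
  qed
  moreover have "opt_value differentiable at \<theta>" if "\<theta> \<in> \<Theta>" for \<theta>
    using plan_exists[OF that] GDERIV_opt_value[OF that]
    unfolding gderiv_def differentiable_def by blast
  ultimately show ?thesis
    using L1_nonneg lam_pos by (auto simp: lipschitz_smooth_on_def lipschitz_on_def)
qed

lemma L1_norm_plan_diff_le:
  assumes "\<theta>1 \<in> \<Theta>" "\<theta>2 \<in> \<Theta>" "plan \<theta>1 a" "plan \<theta>2 b"
  shows "L1_norm M N (\<lambda>z. a z - b z) \<le> ennreal (L0 / lam * norm (\<theta>1 - \<theta>2))"
proof -
  have "integrable P (\<lambda>z. \<bar>a z - b z\<bar>)"
    using assms(3,4)[THEN plan_coupling] by (simp add: couplings_integrable)
  then have "L1_norm M N (\<lambda>z. a z - b z) = ennreal (\<integral>z. \<bar>a z - b z\<bar> \<partial>P)"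
    unfolding L1_norm_def by (intro nn_integral_eq_integral) auto
  then show ?thesis
    using plan_lipschitz[OF assms] by (simp add: ennreal_leI)
qed

end

theorem theorem3p1:
  fixes M :: "'a measure" and N :: "'d::euclidean_space measure"
    and q :: "'a \<Rightarrow> real" and p :: "'d \<Rightarrow> real"
    and \<Theta> :: "'t::euclidean_space set"
    and G :: "'t \<Rightarrow> 'a \<Rightarrow> 'd" and c :: "'d \<Rightarrow> 'd \<Rightarrow> real"
    and lam L0 L1 :: real
  assumes "sigma_finite_measure M" and "sigma_finite_measure N"
    and "prob_density M q" and "prob_density N p"
    and "open \<Theta>"
    and "\<And>\<theta>. \<theta> \<in> \<Theta> \<Longrightarrow> inj_on (G \<theta>) (space M)"
    and "\<And>\<theta>. \<theta> \<in> \<Theta> \<Longrightarrow> (\<lambda>(x, y). c (G \<theta> x) y) \<in> borel_measurable (M \<Otimes>\<^sub>M N)"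
    and "\<And>x y \<theta>. x \<in> space M \<Longrightarrow> y \<in> space N \<Longrightarrow> \<theta> \<in> \<Theta> \<Longrightarrow>
           (\<lambda>\<theta>. c (G \<theta> x) y) differentiable (at \<theta>)"
    and min_attained: "\<And>\<theta>. \<theta> \<in> \<Theta> \<Longrightarrow>
           \<exists>\<pi>. OT_plan M N q p c G lam \<theta> \<pi> \<and> \<bar>OT_objective M N q p c G lam \<pi> \<theta>\<bar> \<noteq> \<infinity>"
    and "lam > 0" and "L0 \<ge> 0" and "L1 \<ge> 0"
    and "\<And>\<theta>1 \<theta>2. \<theta>1 \<in> \<Theta> \<Longrightarrow> \<theta>2 \<in> \<Theta> \<Longrightarrow>
           (SUP (x, y)\<in>space M \<times> space N.
              ereal (norm (grad (\<lambda>\<theta>. c (G \<theta> x) y) \<theta>1 - grad (\<lambda>\<theta>. c (G \<theta> x) y) \<theta>2)))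
           \<le> ereal (L1 * norm (\<theta>1 - \<theta>2))"
    and "\<And>\<theta>1. \<theta>1 \<in> \<Theta> \<Longrightarrow>
           (SUP (x, y)\<in>space M \<times> space N. ereal (norm (grad (\<lambda>\<theta>. c (G \<theta> x) y) \<theta>1)))
           \<le> ereal L0"
    and "\<And>\<theta>1 \<theta>2. \<theta>1 \<in> \<Theta> \<Longrightarrow> \<theta>2 \<in> \<Theta> \<Longrightarrow>
           (SUP (x, y)\<in>space M \<times> space N. ereal \<bar>c (G \<theta>1 x) y - c (G \<theta>2 x) y\<bar>)
           \<le> ereal (L0 * norm (\<theta>1 - \<theta>2))"
  shows "lipschitz_smooth_on \<Theta> (L1 + L0\<^sup>2 / lam) (OT_value M N q p c G lam) \<and>
    (\<forall>\<theta>1\<in>\<Theta>. \<forall>\<theta>2\<in>\<Theta>. \<forall>\<pi>1 \<pi>2.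
       OT_plan M N q p c G lam \<theta>1 \<pi>1 \<longrightarrow> OT_plan M N q p c G lam \<theta>2 \<pi>2 \<longrightarrow>
       L1_norm M N (\<lambda>z. \<pi>1 z - \<pi>2 z) \<le> ennreal (L0 / lam * norm (\<theta>1 - \<theta>2)))"
proof -
  interpret pair_sigma_finite M N
    using assms(1,2) by (rule pair_sigma_finite.intro)
  have space: "z \<in> space (M \<Otimes>\<^sub>M N) \<longleftrightarrow> fst z \<in> space M \<and> snd z \<in> space N" for z
    by (simp add: space_pair_measure mem_Times_iff)
  interpret entropic_transport M N q p \<Theta> G c lam L0 L1
  proof
    show "(\<lambda>z. c (G \<theta> (fst z)) (snd z)) \<in> borel_measurable (M \<Otimes>\<^sub>M N)" if "\<theta> \<in> \<Theta>" for \<theta>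
      using assms(7)[OF that] by (simp add: case_prod_beta')
    show "(\<lambda>\<theta>. c (G \<theta> (fst z)) (snd z)) differentiable (at \<theta>)"
      if "z \<in> space (M \<Otimes>\<^sub>M N)" "\<theta> \<in> \<Theta>" for z \<theta>
      using assms(8) that by (simp add: space)
    show "norm (grad (\<lambda>\<theta>. c (G \<theta> (fst z)) (snd z)) \<theta>1 - grad (\<lambda>\<theta>. c (G \<theta> (fst z)) (snd z)) \<theta>2)
        \<le> L1 * norm (\<theta>1 - \<theta>2)"
      if "z \<in> space (M \<Otimes>\<^sub>M N)" "\<theta>1 \<in> \<Theta>" "\<theta>2 \<in> \<Theta>" for z \<theta>1 \<theta>2
      using assms(13)[OF that(2,3)] that(1) by (force simp: SUP_le_iff space)
    show "norm (grad (\<lambda>\<theta>. c (G \<theta> (fst z)) (snd z)) \<theta>) \<le> L0"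
      if "z \<in> space (M \<Otimes>\<^sub>M N)" "\<theta> \<in> \<Theta>" for z \<theta>
      using assms(14)[OF that(2)] that(1) by (force simp: SUP_le_iff space)
    show "\<bar>c (G \<theta>1 (fst z)) (snd z) - c (G \<theta>2 (fst z)) (snd z)\<bar> \<le> L0 * norm (\<theta>1 - \<theta>2)"
      if "z \<in> space (M \<Otimes>\<^sub>M N)" "\<theta>1 \<in> \<Theta>" "\<theta>2 \<in> \<Theta>" for z \<theta>1 \<theta>2
      using assms(15)[OF that(2,3)] that(1) by (force simp: SUP_le_iff space)
  qed (fact assms)+
  show ?thesis
    using opt_value_lipschitz_smooth L1_norm_plan_diff_le by blast
qed

end
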